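(* Let $\tilde{v},\tilde{a},\tilde{c}\in\mathbb{R}^n$, and for $\tilde{b}\in\mathbb{R}^n$ let $F(\tilde{b})$ be the face of $P_{n-1}(\tilde{v})$ of points maximizing $\tilde{x}\mapsto\tilde{b}\cdot\tilde{x}$. Let $[n]=X_1(\tilde{a})\cup\cdots\cup X_h(\tilde{a})$ be the ordered partition of $[n]$ into level sets of $\tilde{a}$ ($a_i=a_j$ within a part, and $a_i<a_j$ for $i\in X_\ell(\tilde{a})$, $j\in X_{\ell'}(\tilde{a})$, $\ell<\ell'$). Assume $\tilde{a}$ is $\tilde{v}$-reduced, i.e. $\delta_{X_\ell(\tilde{a})\cup X_{\ell+1}(\tilde{a})}(\tilde{v})=1$ for every $\ell\in\{1,\ldots,h-1\}$, and assume $\tilde{v}\in F(\tilde{a})$. Then $F(\tilde{a})\subseteq F(\tilde{c})$ if and only if both of the following hold: (1) for all $i,j$, $a_i<a_j$ implies $c_i\le c_j$; (2) for every part $X_\ell(\tilde{a})$ with $\delta_{X_\ell(\tilde{a})}(\tilde{v})=1$ we have $\delta_{X_\ell(\tilde{a})}(\tilde{c})=0$.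
   Context: $P_{n-1}(\tilde{v})$ is the convex hull of $\{(v_{\pi(1)},\ldots,v_{\pi(n)}):\pi\in S_n\}$. For $X\subseteq[n]$ and $\tilde{b}\in\mathbb{R}^n$, $\delta_X(\tilde{b})=0$ if the coordinates $b_i$, $i\in X$, are all equal, and $\delta_X(\tilde{b})=1$ otherwise. *)

theory Defs
  imports "HOL-Analysis.Analysis"
begin

definition perm_polytope :: "real ^ 'n \<Rightarrow> (real ^ 'n) set" where
  "perm_polytope v = convex hull {(\<chi> i. v $ \<pi> i) | \<pi>. \<pi> permutes (UNIV :: 'n set)}"

definition max_face :: "real ^ 'n \<Rightarrow> real ^ 'n \<Rightarrow> (real ^ 'n) set" where
  "max_face v b = {x \<in> perm_polytope v. \<forall>y \<in> perm_polytope v. b \<bullet> y \<le> b \<bullet> x}"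

definition delta :: "'n set \<Rightarrow> real ^ 'n \<Rightarrow> nat" where
  "delta X b = (if \<forall>i\<in>X. \<forall>j\<in>X. b $ i = b $ j then 0 else 1)"

text \<open>
  \<open>X 1, \<dots>, X h\<close> are the level sets of \<open>a\<close>, listed in increasing order of the value of \<open>a\<close>;
  the values of \<open>X\<close> outside \<open>{1..h}\<close> are irrelevant.
\<close>

definition level_partition :: "real ^ 'n \<Rightarrow> nat \<Rightarrow> (nat \<Rightarrow> 'n set) \<Rightarrow> bool" where
  "level_partition a h X \<longleftrightarrow>
     (\<Union>l\<in>{1..h}. X l) = UNIV \<and>
     disjoint_family_on X {1..h} \<and>
     (\<forall>l\<in>{1..h}. X l \<noteq> {}) \<and>
     (\<forall>l\<in>{1..h}. \<forall>i\<in>X l. \<forall>j\<in>X l. a $ i = a $ j) \<and>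
     (\<forall>l\<in>{1..h}. \<forall>l'\<in>{1..h}. l < l' \<longrightarrow> (\<forall>i\<in>X l. \<forall>j\<in>X l'. a $ i < a $ j))"

lemma level_partition_exists:
  fixes a :: "real ^ 'n"
  shows "\<exists>h X. level_partition a h X"
proof -
  define S where "S = range (($) a)"
  define xs where "xs = sorted_list_of_set S"
  define X where "X l = {i. a $ i = xs ! (l - 1)}" for l :: nat
  have fin: "finite S" by (simp add: S_def)
  have xs: "set xs = S" "sorted_wrt (<) xs"
    using fin by (simp_all add: xs_def)
  have less: "xs ! (l - 1) < xs ! (l' - 1)"
    if "l \<in> {1..length xs}" "l' \<in> {1..length xs}" "l < l'" for l l'
    using that by (intro sorted_wrt_nth_less[OF xs(2)]) auto
  have "i \<in> (\<Union>l\<in>{1..length xs}. X l)" for i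
  proof -
    have "a $ i \<in> set xs" by (simp add: xs S_def)
    then obtain k where "k < length xs" "xs ! k = a $ i" by (auto simp: in_set_conv_nth)
    then show ?thesis by (intro UN_I[of "Suc k"]) (auto simp: X_def)
  qed
  moreover have "X l \<noteq> {}" if "l \<in> {1..length xs}" for l
  proof -
    have "xs ! (l - 1) \<in> S" using that xs(1) nth_mem[of "l - 1" xs] by auto
    then show ?thesis by (auto simp: X_def S_def)
  qed
  moreover have "disjoint_family_on X {1..length xs}"
    unfolding disjoint_family_on_def
  proof (intro ballI impI)
    fix l l' assume "l \<in> {1..length xs}" "l' \<in> {1..length xs}" "l \<noteq> l'"
    then show "X l \<inter> X l' = {}"
      using less[of l l'] less[of l' l] by (cases "l < l'") (auto simp: X_def)
  qed
  ultimately have "level_partition a (length xs) X"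
    unfolding level_partition_def using less by (auto simp: X_def)
  then show ?thesis by blast
qed

end

theory Submission imports Defs begin

text \<open>
  By the rearrangement inequality, \<open>v\<close> maximizes \<open>b\<close> over its permutohedron iff \<open>b $ i < b $ j\<close>
  implies \<open>v $ i \<le> v $ j\<close>.  If \<open>F(a) \<subseteq> F(c)\<close>, then transposing two coordinates of \<open>v\<close> within a
  level set of \<open>a\<close> stays in \<open>F(a)\<close>, hence leaves \<open>c \<bullet> v\<close> unchanged; this gives (2), and (1) follows
  for neighbouring level sets because \<open>a\<close> is \<open>v\<close>-reduced.  Conversely, (1) and (2) imply that \<open>v\<close>
  maximizes both \<open>c\<close> and \<open>K a - c\<close> for large \<open>K\<close>; a maximizer \<open>x\<close> of \<open>a\<close> satisfies
  \<open>a \<bullet> x = a \<bullet> v\<close>, and the two inequalities force \<open>c \<bullet> x = c \<bullet> v\<close>.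
\<close>

section \<open>Rearrangement inequality\<close>

lemma finite_ex_maximizer:
  fixes f :: "'a \<Rightarrow> 'b :: linorder"
  assumes "finite S" "S \<noteq> {}"
  obtains m where "m \<in> S" "\<And>k. k \<in> S \<Longrightarrow> f k \<le> f m"
proof -
  have "Max (f ` S) \<in> f ` S" using assms by (intro Max_in) auto
  then obtain m where "m \<in> S" "f m = Max (f ` S)" by auto
  then show thesis using that[of m] assms(1) by simp
qed

text \<open>Induction on \<open>S\<close>: some \<open>m\<close> maximizes \<open>b\<close> and
  \<open>v\<close> at once, and composing \<open>\<pi>\<close> with a transposition that makes it
  fix \<open>m\<close> does not decrease the sum. Then \<open>m\<close> can be split off.\<close>

lemma rearrangement_inequality:
  fixes b v :: "'a \<Rightarrow> real"
  assumes "finite S" "\<pi> permutes S"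
    and "\<And>i j. i \<in> S \<Longrightarrow> j \<in> S \<Longrightarrow> b i < b j \<Longrightarrow> v i \<le> v j"
  shows "(\<Sum>i\<in>S. b i * v (\<pi> i)) \<le> (\<Sum>i\<in>S. b i * v i)"
  using assms
proof (induction S arbitrary: \<pi> rule: finite_psubset_induct)
  case (psubset S)
  show ?case
  proof (cases "S = {}")
    case False
    \<comment> \<open>The hypothesis is silent where \<open>b\<close> ties, so \<open>m\<close> is
      chosen with the largest \<open>v\<close> among the maximizers of \<open>b\<close>.\<close>
    have "\<exists>m\<in>S. \<forall>k\<in>S. b k \<le> b m \<and> v k \<le> v m"
    proof -
      obtain m0 where m0: "m0 \<in> S" "\<And>k. k \<in> S \<Longrightarrow> b k \<le> b m0"
        using finite_ex_maximizer[OF psubset.hyps(1) False] by blast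
      let ?T = "{k \<in> S. b k = b m0}"
      have "finite ?T" "?T \<noteq> {}" using m0 psubset.hyps by auto
      then obtain m where m: "m \<in> ?T" "\<And>k. k \<in> ?T \<Longrightarrow> v k \<le> v m"
        by (rule finite_ex_maximizer[where f = v]) blast
      have "b k \<le> b m \<and> v k \<le> v m" if k: "k \<in> S" for k
      proof (cases "b k = b m0")
        case True
        then show ?thesis using m k by simp
      next
        case False
        then have "b k < b m" using m(1) m0(2)[OF k] by simp
        then show ?thesis using psubset.prems(2)[OF k, of m] m(1) by simp
      qed
      then show ?thesis using m by blast
    qed
    then obtain m where m: "m \<in> S" "\<And>k. k \<in> S \<Longrightarrow> b k \<le> b m" "\<And>k. k \<in> S \<Longrightarrow> v k \<le> v m"
      by blast
    define q where "q = \<pi> m"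
    define \<sigma> where "\<sigma> = Transposition.transpose m q \<circ> \<pi>"
    have q: "q \<in> S" using m psubset.prems(1) by (simp add: q_def permutes_in_image)
    have \<sigma>S: "\<sigma> permutes S"
      unfolding \<sigma>_def by (intro permutes_compose psubset.prems permutes_swap_id m q)
    have \<sigma>m: "\<sigma> m = m" by (simp add: \<sigma>_def q_def)
    have \<sigma>: "\<sigma> permutes (S - {m})"
      by (rule permutes_superset[OF \<sigma>S]) (use \<sigma>m in auto)
    obtain p where p: "p \<in> S" "\<pi> p = m"
      using psubset.prems(1) m(1) by (metis permutes_image image_iff)
    have inj: "\<pi> x = \<pi> y \<longleftrightarrow> x = y" for x y
      using permutes_inj[OF psubset.prems(1)] by (simp add: inj_eq)
    have "(\<Sum>i\<in>S. b i * v (\<pi> i)) \<le> (\<Sum>i\<in>S. b i * v (\<sigma> i))"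
    proof (cases "p = m")
      case True
      then have "\<sigma> = \<pi>" using p by (simp add: \<sigma>_def q_def)
      then show ?thesis by simp
    next
      case pm: False
      have S: "S = insert m (insert p (S - {m, p}))" using m p by auto
      have eq: "(\<Sum>i\<in>S. f i) = f m + f p + (\<Sum>i\<in>S - {m, p}. f i)" for f :: "'a \<Rightarrow> real"
        using pm psubset.hyps by (subst S) (simp add: algebra_simps)
      have rest: "(\<Sum>i\<in>S - {m, p}. b i * v (\<pi> i)) = (\<Sum>i\<in>S - {m, p}. b i * v (\<sigma> i))"
      proof (rule sum.cong[OF refl])
        fix i assume "i \<in> S - {m, p}"
        then have "\<pi> i \<noteq> q" "\<pi> i \<noteq> m" using inj[of i m] inj[of i p] p by (auto simp: q_def)
        then show "b i * v (\<pi> i) = b i * v (\<sigma> i)" by (simp add: \<sigma>_def)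
      qed
      have "\<sigma> p = q" using p by (simp add: \<sigma>_def)
      \<comment> \<open>This product is the gain in the sum from \<open>\<pi>\<close> to
        \<open>\<sigma>\<close>: \<open>m\<close> and \<open>p\<close> had the values
        \<open>v q\<close> and \<open>v m\<close>, and now have \<open>v m\<close> and
        \<open>v q\<close>.\<close>
      moreover have "0 \<le> (b m - b p) * (v m - v q)"
        using m p q by (intro mult_nonneg_nonneg) auto
      ultimately show ?thesis
        unfolding eq[of "\<lambda>i. b i * v (\<pi> i)"] eq[of "\<lambda>i. b i * v (\<sigma> i)"] rest
        by (simp add: \<sigma>m p(2) q_def[symmetric] algebra_simps)
    qed
    also have "\<dots> = b m * v m + (\<Sum>i\<in>S - {m}. b i * v (\<sigma> i))"
      using m(1) psubset.hyps by (simp add: sum.remove[of S m] \<sigma>m)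
    also have "\<dots> \<le> b m * v m + (\<Sum>i\<in>S - {m}. b i * v i)"
      using psubset.IH[of "S - {m}" \<sigma>] \<sigma> psubset.prems(2) m(1) by auto
    also have "\<dots> = (\<Sum>i\<in>S. b i * v i)"
      using m(1) psubset.hyps by (simp add: sum.remove[of S m])
    finally show ?thesis .
  qed simp
qed

section \<open>Swapping coordinates, and when \<open>v\<close> is a maximizer\<close>

definition swap_coords :: "'n \<Rightarrow> 'n \<Rightarrow> real ^ 'n \<Rightarrow> real ^ 'n" where
  "swap_coords i j v = (\<chi> k. v $ Transposition.transpose i j k)"

lemma permuted_in_perm_polytope:
  assumes "\<pi> permutes (UNIV :: 'n set)"
  shows "(\<chi> i. v $ \<pi> i) \<in> perm_polytope (v :: real ^ 'n)"
  unfolding perm_polytope_def by (rule hull_inc) (use assms in blast)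

lemma self_in_perm_polytope: "v \<in> perm_polytope v"
  using permuted_in_perm_polytope[OF permutes_id, of v] by simp

lemma swap_coords_in_perm_polytope: "swap_coords i j v \<in> perm_polytope v"
  unfolding swap_coords_def
  by (intro permuted_in_perm_polytope permutes_swap_id) auto

lemma inner_swap_coords:
  fixes b v :: "real ^ 'n"
  shows "b \<bullet> swap_coords i j v = b \<bullet> v - (b $ i - b $ j) * (v $ i - v $ j)"
proof (cases "i = j")
  case True
  then show ?thesis by (simp add: swap_coords_def)
next
  case False
  have eq: "(\<Sum>k\<in>UNIV. f k) = f i + f j + (\<Sum>k\<in>UNIV - {i, j}. f k)" for f :: "'n \<Rightarrow> real"
  proof -
    have U: "UNIV = insert i (insert j (UNIV - {i, j}))" by auto
    show ?thesis using False by (subst U) (simp add: algebra_simps)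
  qed
  have "(\<Sum>k\<in>UNIV - {i, j}. b $ k * v $ Transposition.transpose i j k) =
        (\<Sum>k\<in>UNIV - {i, j}. b $ k * v $ k)"
    by (rule sum.cong) auto
  then show ?thesis
    by (simp add: inner_vec_def swap_coords_def eq algebra_simps)
qed

text \<open>Necessity: no swap of two coordinates may increase \<open>b \<bullet> v\<close>.
  Sufficiency: rearrangement bounds the generating points, and a halfspace is convex, so it contains
  their hull.\<close>

lemma self_in_max_face_iff:
  fixes v b :: "real ^ 'n"
  shows "v \<in> max_face v b \<longleftrightarrow> (\<forall>i j. b $ i < b $ j \<longrightarrow> v $ i \<le> v $ j)"
proof
  assume v: "v \<in> max_face v b"
  show "\<forall>i j. b $ i < b $ j \<longrightarrow> v $ i \<le> v $ j"
  proof (intro allI impI)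
    fix i j assume ij: "b $ i < b $ j"
    have "b \<bullet> swap_coords i j v \<le> b \<bullet> v"
      using v swap_coords_in_perm_polytope by (auto simp: max_face_def)
    then have "0 \<le> (b $ i - b $ j) * (v $ i - v $ j)" by (simp add: inner_swap_coords)
    then show "v $ i \<le> v $ j" using ij by (auto simp: zero_le_mult_iff)
  qed
next
  assume mono: "\<forall>i j. b $ i < b $ j \<longrightarrow> v $ i \<le> v $ j"
  have "perm_polytope v \<subseteq> {y. b \<bullet> y \<le> b \<bullet> v}"
    unfolding perm_polytope_def
  proof (rule hull_minimal)
    show "{(\<chi> i. v $ \<pi> i) |\<pi>. \<pi> permutes UNIV} \<subseteq> {y. b \<bullet> y \<le> b \<bullet> v}"
      using rearrangement_inequality[of UNIV _ "($) b" "($) v"] mono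
      by (auto simp: inner_vec_def)
  qed (rule convex_halfspace_le)
  then show "v \<in> max_face v b"
    using self_in_perm_polytope by (auto simp: max_face_def)
qed

section \<open>Level sets of \<open>a\<close>\<close>

lemma level_partition_same_part:
  assumes "level_partition a h X" "a $ i = a $ j"
  obtains l where "l \<in> {1..h}" "i \<in> X l" "j \<in> X l"
proof -
  have cover: "(\<Union>l\<in>{1..h}. X l) = UNIV"
    and less: "\<And>l l'. l \<in> {1..h} \<Longrightarrow> l' \<in> {1..h} \<Longrightarrow> l < l' \<Longrightarrow>
                 \<forall>i\<in>X l. \<forall>j\<in>X l'. a $ i < a $ j"
    using assms(1) unfolding level_partition_def by blast+
  obtain l l' where l: "l \<in> {1..h}" "i \<in> X l" and l': "l' \<in> {1..h}" "j \<in> X l'"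
    using cover by blast
  have "l = l'"
    using less[OF l(1) l'(1)] less[OF l'(1) l(1)] l l' assms(2)
    by (metis less_irrefl linorder_neqE_nat)
  with l l' that show thesis by blast
qed

text \<open>Reduces condition (1) to neighbouring parts, the only ones about which
  \<open>v\<close>-reducedness speaks.\<close>

lemma level_partition_mono_if_adjacent:
  assumes part: "level_partition a h X"
    and adj: "\<And>l i j. l \<in> {1..<h} \<Longrightarrow> i \<in> X l \<Longrightarrow> j \<in> X (l + 1) \<Longrightarrow> c $ i \<le> (c $ j :: real)"
    and ij: "a $ i < a $ j"
  shows "c $ i \<le> c $ j"
proof -
  have cover: "(\<Union>l\<in>{1..h}. X l) = UNIV"
    and ne: "\<And>l. l \<in> {1..h} \<Longrightarrow> X l \<noteq> {}"
    and const: "\<And>l. l \<in> {1..h} \<Longrightarrow> \<forall>i\<in>X l. \<forall>j\<in>X l. a $ i = a $ j"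
    and less: "\<And>l l'. l \<in> {1..h} \<Longrightarrow> l' \<in> {1..h} \<Longrightarrow> l < l' \<Longrightarrow>
                 \<forall>i\<in>X l. \<forall>j\<in>X l'. a $ i < a $ j"
    using part unfolding level_partition_def by blast+
  \<comment> \<open>Here \<open>d\<close> counts the parts strictly in between; they are nonempty,
    so a chain of elements runs through them.\<close>
  have step: "c $ i \<le> c $ j" if "l + Suc d \<le> h" "1 \<le> l" "i \<in> X l" "j \<in> X (l + Suc d)" for l d i j
    using that
  proof (induction d arbitrary: j)
    case 0
    then show ?case using adj[of l i j] by auto
  next
    case (Suc d)
    obtain k where k: "k \<in> X (l + Suc d)" using ne[of "l + Suc d"] Suc.prems by auto
    have "c $ i \<le> c $ k" using Suc k by auto
    also have "\<dots> \<le> c $ j" using adj[of "l + Suc d" k j] Suc.prems k by auto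
    finally show ?case .
  qed
  obtain l l' where l: "l \<in> {1..h}" "i \<in> X l" and l': "l' \<in> {1..h}" "j \<in> X l'"
    using cover by blast
  have "\<not> l' < l" using less[OF l'(1) l(1)] l l' ij by (meson less_asym)
  moreover have "l \<noteq> l'" using const[OF l(1)] l l' ij by (metis less_irrefl)
  ultimately have "l < l'" by simp
  then obtain d where "l' = l + Suc d" using less_imp_Suc_add by fastforce
  then show ?thesis using step[of l d i j] l l' by auto
qed

section \<open>Containment of faces\<close>

lemma max_face_inner_eq:
  assumes "x \<in> max_face v b" "y \<in> max_face v b"
  shows "b \<bullet> x = b \<bullet> y"
  using assms unfolding max_face_def by (intro antisym) blast+

lemma delta_eq_0_iff: "delta X b = 0 \<longleftrightarrow> (\<forall>i\<in>X. \<forall>j\<in>X. b $ i = b $ j)"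
  and delta_eq_1_iff: "delta X b = 1 \<longleftrightarrow> \<not> (\<forall>i\<in>X. \<forall>j\<in>X. b $ i = b $ j)"
  unfolding delta_def by (metis zero_neq_one)+

text \<open>Swapping \<open>i\<close> and \<open>j\<close> keeps \<open>v\<close> in the face of
  \<open>a\<close>, hence in that of \<open>c\<close>, where the functional \<open>c\<close> is
  constant. So \<open>(c $ i - c $ j) * (v $ i - v $ j)\<close> vanishes.\<close>

lemma max_face_subset_swap:
  fixes v a c :: "real ^ 'n"
  assumes sub: "max_face v a \<subseteq> max_face v c" and v: "v \<in> max_face v a"
    and a: "a $ i = a $ j" and "v $ i \<noteq> v $ j"
  shows "c $ i = c $ j"
proof -
  have "swap_coords i j v \<in> max_face v a"
    using v a swap_coords_in_perm_polytope by (auto simp: max_face_def inner_swap_coords)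
  then have "c \<bullet> swap_coords i j v = c \<bullet> v"
    using sub v by (intro max_face_inner_eq) auto
  then show ?thesis using assms(4) by (simp add: inner_swap_coords)
qed

lemma max_face_subset_delta:
  fixes v a c :: "real ^ 'n"
  assumes sub: "max_face v a \<subseteq> max_face v c" and v: "v \<in> max_face v a"
    and const: "\<forall>i\<in>Y. \<forall>j\<in>Y. a $ i = a $ j" and "delta Y v = 1"
  shows "delta Y c = 0"
  unfolding delta_eq_0_iff
proof (intro ballI)
  fix i j assume ij: "i \<in> Y" "j \<in> Y"
  \<comment> \<open>If \<open>v $ i = v $ j\<close>, the swap argument does not apply to
    \<open>i\<close> and \<open>j\<close> directly; \<open>k\<close> then differs from both in
    \<open>v\<close> and links them.\<close>
  obtain k where k: "k \<in> Y" "v $ k \<noteq> v $ i"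
    using assms(4) unfolding delta_eq_1_iff by metis
  have swap: "c $ p = c $ q" if "p \<in> Y" "q \<in> Y" "v $ p \<noteq> v $ q" for p q
    using max_face_subset_swap[OF sub v] const that by blast
  show "c $ i = c $ j"
    using swap[of i j] swap[of i k] swap[of k j] ij k by metis
qed

lemma max_face_subset_mono:
  fixes v a c :: "real ^ 'n"
  assumes part: "level_partition a h X"
    and red: "\<forall>l\<in>{1..<h}. delta (X l \<union> X (l + 1)) v = 1"
    and sub: "max_face v a \<subseteq> max_face v c" and v: "v \<in> max_face v a"
    and ij: "a $ i < a $ j"
  shows "c $ i \<le> c $ j"
proof (rule level_partition_mono_if_adjacent[OF part _ ij])
  fix l i j assume l: "l \<in> {1..<h}" and i: "i \<in> X l" and j: "j \<in> X (l + 1)"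
  have l': "l \<in> {1..h}" "l + 1 \<in> {1..h}" using l by simp_all
  have const: "\<forall>i\<in>X l. \<forall>j\<in>X l. a $ i = a $ j" "\<forall>i\<in>X (l+1). \<forall>j\<in>X (l+1). a $ i = a $ j"
    using part l' unfolding level_partition_def by blast+
  have "l < l + 1" by simp
  then have less: "\<forall>i\<in>X l. \<forall>j\<in>X (l+1). a $ i < a $ j"
    using part l' unfolding level_partition_def by blast
  have v_le: "v $ p \<le> v $ q" if "p \<in> X l" "q \<in> X (l + 1)" for p q
    using v less that unfolding self_in_max_face_iff by blast
  have "v \<in> max_face v c" using sub v by blast
  then have c_le: "c $ p \<le> c $ q" if "v $ p < v $ q" for p q
    unfolding self_in_max_face_iff using that by (meson not_le)
  show "c $ i \<le> c $ j"
  proof (cases "v $ i = v $ j")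
    case False
    then show ?thesis using v_le[OF i j] c_le by simp
  next
    case True
    \<comment> \<open>With \<open>v\<close> tied at \<open>i\<close> and \<open>j\<close>,
      reducedness supplies \<open>k\<close> with another value. Swapping identifies
      \<open>c $ k\<close> with the value of \<open>c\<close> at whichever of \<open>i\<close>,
      \<open>j\<close> shares its part, and \<open>v\<close> strictly separates \<open>k\<close>
      from the other one.\<close>
    obtain k where k: "k \<in> X l \<union> X (l + 1)" "v $ k \<noteq> v $ i"
      using red l unfolding delta_eq_1_iff by metis
    show ?thesis
    proof (cases "k \<in> X l")
      case kl: True
      have "c $ i = c $ k" using max_face_subset_swap[OF sub v] const kl i k by metis
      then show ?thesis using c_le[of k j] v_le[OF kl j] k True by simp
    next
      case False
      then have kl: "k \<in> X (l + 1)" using k by blast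
      have "c $ j = c $ k" using max_face_subset_swap[OF sub v] const kl j k True by metis
      then show ?thesis using c_le[of i k] v_le[OF i kl] k True by simp
    qed
  qed
qed

lemma max_face_subsetI:
  fixes v a c :: "real ^ 'n"
  assumes v: "v \<in> max_face v a"
    and mono: "\<And>i j. a $ i < a $ j \<Longrightarrow> c $ i \<le> c $ j"
    and level: "\<And>i j. a $ i = a $ j \<Longrightarrow> v $ i \<noteq> v $ j \<Longrightarrow> c $ i = c $ j"
  shows "max_face v a \<subseteq> max_face v c"
proof
  fix x assume x: "x \<in> max_face v a"
  have v_le: "v $ i \<le> v $ j" if "a $ i < a $ j" for i j
    using v that unfolding self_in_max_face_iff by blast
  have vc: "v \<in> max_face v c"
    unfolding self_in_max_face_iff
  proof (intro allI impI)
    fix i j assume "c $ i < c $ j"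
    then show "v $ i \<le> v $ j"
      using v_le[of i j] mono[of j i] level[of i j]
      by (cases "a $ i" "a $ j" rule: linorder_cases) force+
  qed
  \<comment> \<open>\<open>K\<close> will bound the finitely many slopes of \<open>c\<close> against
    \<open>a\<close>. Pairs with equal \<open>a\<close> contribute 0 by the convention for division
    by zero, which is harmless: \<open>K\<close> is used only where
    \<open>a $ i < a $ j\<close>.\<close>
  define slope where "slope = (\<lambda>(i, j). (c $ j - c $ i) / (a $ j - a $ i))"
  have "bdd_above (range slope)" by (rule bdd_above_finite) simp
  then obtain K where "\<And>i j. slope (i, j) \<le> K" by (auto simp: bdd_above_def)
  then have K: "c $ j - c $ i \<le> K * (a $ j - a $ i)" if "a $ i < a $ j" for i j
    using that by (auto simp: slope_def divide_le_eq dest: spec)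
  \<comment> \<open>By the choice of \<open>K\<close>, the functional
    \<open>K *\<^sub>R a - c\<close> is weakly increasing along \<open>a\<close>; where
    \<open>a\<close> ties, it can differ only if \<open>c\<close> does, and then
    \<open>level\<close> forces equal \<open>v\<close>.\<close>
  have vd: "v \<in> max_face v (K *\<^sub>R a - c)"
    unfolding self_in_max_face_iff
  proof (intro allI impI)
    fix i j assume "(K *\<^sub>R a - c) $ i < (K *\<^sub>R a - c) $ j"
    then have "K * a $ i - c $ i < K * a $ j - c $ j" by simp
    then show "v $ i \<le> v $ j"
      using v_le[of i j] K[of j i] level[of i j]
      by (cases "a $ i" "a $ j" rule: linorder_cases) (force simp: algebra_simps)+
  qed
  have "x \<in> perm_polytope v" using x by (simp add: max_face_def)
  then have "(K *\<^sub>R a - c) \<bullet> x \<le> (K *\<^sub>R a - c) \<bullet> v" using vd by (simp add: max_face_def)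
  \<comment> \<open>The terms in \<open>K\<close> now cancel, which turns the bound for
    \<open>K *\<^sub>R a - c\<close> into a lower bound for \<open>c \<bullet> x\<close>.\<close>
  moreover have "a \<bullet> x = a \<bullet> v" by (rule max_face_inner_eq[OF x v])
  ultimately have "c \<bullet> v \<le> c \<bullet> x" by (simp add: inner_diff_left)
  then show "x \<in> max_face v c"
    using vc \<open>x \<in> perm_polytope v\<close> unfolding max_face_def by (blast intro: order_trans)
qed

theorem theorem4p16:
  fixes v a c :: "real ^ 'n" and h :: nat and X :: "nat \<Rightarrow> 'n set"
  assumes "level_partition a h X"
    and "\<forall>l\<in>{1..<h}. delta (X l \<union> X (l + 1)) v = 1"
    and "v \<in> max_face v a"
  shows "max_face v a \<subseteq> max_face v c \<longleftrightarrow>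
           (\<forall>i j. a $ i < a $ j \<longrightarrow> c $ i \<le> c $ j) \<and>
           (\<forall>l\<in>{1..h}. delta (X l) v = 1 \<longrightarrow> delta (X l) c = 0)"
proof
  assume sub: "max_face v a \<subseteq> max_face v c"
  have "\<forall>l\<in>{1..h}. \<forall>i\<in>X l. \<forall>j\<in>X l. a $ i = a $ j"
    using assms(1) unfolding level_partition_def by blast
  then show "(\<forall>i j. a $ i < a $ j \<longrightarrow> c $ i \<le> c $ j) \<and>
        (\<forall>l\<in>{1..h}. delta (X l) v = 1 \<longrightarrow> delta (X l) c = 0)"
    using max_face_subset_mono[OF assms(1,2) sub assms(3)]
      max_face_subset_delta[OF sub assms(3)] by blast
next
  assume R: "(\<forall>i j. a $ i < a $ j \<longrightarrow> c $ i \<le> c $ j) \<and>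
        (\<forall>l\<in>{1..h}. delta (X l) v = 1 \<longrightarrow> delta (X l) c = 0)"
  show "max_face v a \<subseteq> max_face v c"
  proof (rule max_face_subsetI[OF assms(3)])
    fix i j assume "a $ i = a $ j" "v $ i \<noteq> v $ j"
    moreover from \<open>a $ i = a $ j\<close> obtain l where "l \<in> {1..h}" "i \<in> X l" "j \<in> X l"
      by (rule level_partition_same_part[OF assms(1)])
    ultimately show "c $ i = c $ j"
      using R unfolding delta_eq_0_iff delta_eq_1_iff by blast
  qed (use R in blast)
qed

end
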